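(* Let all processes $z\in\mathbb{K}$ satisfy $z(k+t)=z(k)$ for all $k\in\{0,1,2,\dots\}$ and $t\in(0,1)$. Assume that for all $\mu\in(0,1)$ and $n\in\mathbb{N}$ the payoffs $\bar v_n,\bar w_\mu$ are $\mathcal{A}$-measurable. Let, for the game value map $W:\mathfrak{C}_{\mathcal{A}}\to\mathfrak{U}$, $$W[c](\omega)=\sup_{l\in\mathcal{L}(\omega)}\inf_{m\in\mathcal{M}(\omega)}\mathbb{E}^\omega_{lm}c,$$ the payoff families $\bar v_n$ $(n\in\mathbb{N})$ and $\bar w_\mu$ $(0<\mu<1)$ both enjoy the Dynamic Programming Principle. Then the following two statements are equivalent: (i) The maps $\Omega\ni\omega\mapsto\sup_{l\in\mathcal{L}(\omega)}\inf_{m\in\mathcal{M}(\omega)}\mathbb{E}^\omega_{lm}\bar v_n$ converge uniformly on $\Omega$ as $n\uparrow\infty$. (ii) The maps $\Omega\ni\omega\mapsto\sup_{l\in\mathcal{L}(\omega)}\inf_{m\in\mathcal{M}(\omega)}\mathbb{E}^\omega_{lm}\bar w_\mu$ converge uniformly on $\Omega$ as $\mu\downarrow0$. Moreover, when at least one of these statements holds, we have $$\lim_{n\uparrow\infty}\sup_{l\in\mathcal{L}(\omega)}\inf_{m\in\mathcal{M}(\omega)}\mathbb{E}^\omega_{lm}\bar v_n=\lim_{\mu\downarrow0}\sup_{l\in\mathcal{L}(\omega)}\inf_{m\in\mathcal{M}(\omega)}\mathbb{E}^\omega_{lm}\bar w_\mu\qquad\forall\omega\in\Omega.$$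
   Context: Setting: $\mathbb{R}_+=[0,\infty)$, $\mathbb{N}=\{1,2,\dots\}$. $\Omega$ is a nonempty set; $\mathbb{K}$ is a nonempty set of maps from $\mathbb{R}_+$ to $\Omega$; $g:\Omega\to[0,1]$ is a running cost such that for every $z\in\mathbb{K}$ the map $t\mapsto g(z(t))$ is Borel measurable. $\mathfrak{U}$ is the set of all bounded maps $\Omega\to\mathbb{R}$. $\mathcal{A}$ is a $\sigma$-algebra on $\mathbb{K}$, and $\mathfrak{C}_{\mathcal{A}}$ is the set of all $\mathcal{A}$-measurable bounded maps $\mathbb{K}\to\mathbb{R}$. For every $\omega\in\Omega$ there are given nonempty sets $\mathcal{L}(\omega)$ and $\mathcal{M}(\omega)$, and each pair $(l,m)\in\mathcal{L}(\omega)\times\mathcal{M}(\omega)$ induces a probability distribution $\mathbb{P}^\omega_{lm}$ on $(\mathbb{K},\mathcal{A})$, with expectation $\mathbb{E}^\omega_{lm}$. The map $W:\mathfrak{C}_{\mathcal{A}}\to\mathfrak{U}$ is defined by $W[c](\omega)=\sup_{l\in\mathcal{L}(\omega)}\inf_{m\in\mathcal{M}(\omega)}\mathbb{E}^\omega_{lm}c$ for $c\in\mathfrak{C}_{\mathcal{A}}$, $\omega\in\Omega$. (It is a game value map, i.e. $W[Ac+B]=A\,W[c]+B$ for $A\ge0$, $B\in\mathbb{R}$, and $W$ is monotone: $c_1\le c_2$ on $\mathbb{K}$ implies $W[c_1]\le W[c_2]$ on $\Omega$.) Payoffs: for $n\in\mathbb{N}$, $\mu\in(0,1)$, $z\in\mathbb{K}$,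 $$\bar v_n(z)=\frac1n\sum_{t=0}^{n-1}g(z(t)),\qquad \bar w_\mu(z)=\mu\sum_{t=0}^\infty(1-\mu)^t g(z(t)).$$ Dynamic Programming Principle (DPP) for $W$: the family $\bar v_n$ $(n\in\mathbb{N})$ enjoys the DPP iff for all $n,h\in\mathbb{N}$ the payoff $$\mathbb{K}\ni z\mapsto \frac1{n+h}\sum_{t=0}^{h-1}g(z(t))+\frac{n}{n+h}W[\bar v_n](z(h))$$ lies in $\mathfrak{C}_{\mathcal{A}}$ and the value of $W$ at this payoff is $W[\bar v_{n+h}]$. The family $\bar w_\mu$ $(0<\mu<1)$ enjoys the DPP iff for all $\mu\in(0,1)$ and all $h\in\mathbb{N}$ the payoff $$\mathbb{K}\ni z\mapsto \mu\sum_{t=0}^{h-1}(1-\mu)^t g(z(t))+(1-\mu)^hW[\bar w_\mu](z(h))$$ lies in $\mathfrak{C}_{\mathcal{A}}$ and the value of $W$ at this payoff is $W[\bar w_\mu]$. *)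

theory Defs
  imports "HOL-Probability.Probability"
begin

definition bounded_payoffs :: "'a set \<Rightarrow> 'a set set \<Rightarrow> ('a \<Rightarrow> real) set" where
  "bounded_payoffs K \<A> = {c \<in> borel_measurable (sigma K \<A>). bounded (c ` K)}"

text \<open>The value map is meant to be applied to elements of \<^const>\<open>bounded_payoffs\<close> only: there all
  expectations exist, and the suprema and infima are taken over nonempty bounded sets of reals.\<close>

definition game_value ::
  "('w \<Rightarrow> 'l set) \<Rightarrow> ('w \<Rightarrow> 'm set) \<Rightarrow> ('w \<Rightarrow> 'l \<Rightarrow> 'm \<Rightarrow> 'z measure) \<Rightarrow> ('z \<Rightarrow> real) \<Rightarrow> 'w \<Rightarrow> real"
  where "game_value L M P c \<omega> =
    (SUP l\<in>L \<omega>. INF m\<in>M \<omega>. prob_space.expectation (P \<omega> l m) c)"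

definition cesaro_payoff :: "('w \<Rightarrow> real) \<Rightarrow> nat \<Rightarrow> (real \<Rightarrow> 'w) \<Rightarrow> real" where
  "cesaro_payoff g n z = 1 / real n * (\<Sum>t<n. g (z (real t)))"

definition abel_payoff :: "('w \<Rightarrow> real) \<Rightarrow> real \<Rightarrow> (real \<Rightarrow> 'w) \<Rightarrow> real" where
  "abel_payoff g \<mu> z = \<mu> * (\<Sum>t. (1 - \<mu>) ^ t * g (z (real t)))"

text \<open>In the two principles below, \<open>W\<close> is a value map for payoffs on the set \<open>K\<close> of processes,
  its values being functions on \<open>\<Omega>\<close> (hence compared on \<open>\<Omega>\<close> only).\<close>

definition cesaro_DPP ::
  "'w set \<Rightarrow> (real \<Rightarrow> 'w) set \<Rightarrow> (real \<Rightarrow> 'w) set set \<Rightarrow> ('w \<Rightarrow> real) \<Rightarrow>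
    (((real \<Rightarrow> 'w) \<Rightarrow> real) \<Rightarrow> 'w \<Rightarrow> real) \<Rightarrow> bool"
  where "cesaro_DPP \<Omega> K \<A> g W \<longleftrightarrow>
    (\<forall>n\<ge>1. \<forall>h\<ge>1.
      let c = (\<lambda>z. 1 / real (n + h) * (\<Sum>t<h. g (z (real t)))
                 + real n / real (n + h) * W (cesaro_payoff g n) (z (real h)))
      in c \<in> bounded_payoffs K \<A> \<and> (\<forall>\<omega>\<in>\<Omega>. W c \<omega> = W (cesaro_payoff g (n + h)) \<omega>))"

definition abel_DPP ::
  "'w set \<Rightarrow> (real \<Rightarrow> 'w) set \<Rightarrow> (real \<Rightarrow> 'w) set set \<Rightarrow> ('w \<Rightarrow> real) \<Rightarrow>
    (((real \<Rightarrow> 'w) \<Rightarrow> real) \<Rightarrow> 'w \<Rightarrow> real) \<Rightarrow> bool"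
  where "abel_DPP \<Omega> K \<A> g W \<longleftrightarrow>
    (\<forall>\<mu>\<in>{0<..<1}. \<forall>h\<ge>1.
      let c = (\<lambda>z. \<mu> * (\<Sum>t<h. (1 - \<mu>) ^ t * g (z (real t)))
                 + (1 - \<mu>) ^ h * W (abel_payoff g \<mu>) (z (real h)))
      in c \<in> bounded_payoffs K \<A> \<and> (\<forall>\<omega>\<in>\<Omega>. W c \<omega> = W (abel_payoff g \<mu>) \<omega>))"

end

theory Submission
  imports Defs
begin

text \<open>Write \<open>V\<^sub>n\<close> and \<open>U\<^sub>\<mu>\<close> for the values of the Cesaro and Abel payoffs. The value map is
  nonexpansive for the supremum norm, so comparing the two dynamic programming principles over
  a common block of \<open>h\<close> steps bounds \<open>\<parallel>U\<^sub>\<mu> - V\<^bsub>m + h\<^esub>\<parallel>\<close> by \<open>m / (m + h) \<parallel>U\<^sub>\<mu> - V\<^sub>m\<parallel>\<close> plus the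
  distance between the two families of weights on that block. For \<open>\<mu> \<approx> 1 / n\<close>, \<open>n = m + h\<close> and
  \<open>h \<approx> n / k\<close> the weights differ by \<open>O(1 / k\<^sup>2)\<close> only, whereas the contraction factor is
  \<open>1 - 1 / k\<close>. As either uniform limit makes \<open>V\<^sub>m\<close> and \<open>V\<^sub>n\<close>, or \<open>U\<^bsub>1 / m\<^esub>\<close> and \<open>U\<^bsub>1 / n\<^esub>\<close>, uniformly
  close, \<open>\<parallel>U\<^sub>\<mu> - V\<^sub>n\<parallel>\<close> is asymptotically \<open>O(1 / k)\<close> for every \<open>k\<close>.\<close>

section \<open>A Tauberian theorem for recursively related families\<close>

text \<open>Everything the limit argument takes from the game. The premise of
  \<open>block_step\<close> ranges over all of \<open>S\<close> because the state reached after
  \<open>h\<close> steps is arbitrary. The factors 2 arise because the mismatch of the weights is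
  paid once on the block and once in the mass of the remainder.\<close>

locale tauberian_pair =
  fixes S :: "'w set" and V :: "nat \<Rightarrow> 'w \<Rightarrow> real" and U :: "real \<Rightarrow> 'w \<Rightarrow> real"
  assumes nonempty: "S \<noteq> {}"
    and V_range: "\<And>n \<omega>. n \<ge> 1 \<Longrightarrow> \<omega> \<in> S \<Longrightarrow> V n \<omega> \<in> {0..1}"
    and U_range: "\<And>\<mu> \<omega>. \<mu> \<in> {0<..<1} \<Longrightarrow> \<omega> \<in> S \<Longrightarrow> U \<mu> \<omega> \<in> {0..1}"
    and block_step: "\<And>\<mu> m h D \<omega>. \<mu> \<in> {0<..<1} \<Longrightarrow> m \<ge> 1 \<Longrightarrow> h \<ge> 1 \<Longrightarrow>
      (\<And>x. x \<in> S \<Longrightarrow> \<bar>U \<mu> x - V m x\<bar> \<le> D) \<Longrightarrow> \<omega> \<in> S \<Longrightarrow>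
      \<bar>U \<mu> \<omega> - V (m + h) \<omega>\<bar> \<le>
        2 * (real h * \<bar>\<mu> - 1 / real (m + h)\<bar>) + 2 * (real h * \<mu>)\<^sup>2 + real m / real (m + h) * D"
begin

lemma dist_le_1:
  assumes "n \<ge> 1" "\<mu> \<in> {0<..<1}" "\<omega> \<in> S"
  shows "\<bar>U \<mu> \<omega> - V n \<omega>\<bar> \<le> 1"
  using V_range[OF assms(1,3)] U_range[OF assms(2,3)] by auto

text \<open>The contraction factor is the Cesaro weight \<open>m / n\<close> left after a block of
  about \<open>n / k\<close> steps. The bound \<open>n \<le> 2 * m\<close> makes \<open>m\<close>
  grow with \<open>n\<close>, so that limit estimates are available at both indices.\<close>

lemma contraction:
  assumes k: "k \<ge> 4" "k \<le> n" and \<mu>: "\<mu> \<in> {0<..<1}" "real n * \<mu> \<le> 2"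
  obtains m where "m \<ge> 1" "m \<le> n" "n \<le> 2 * m"
    "\<And>D \<omega>. (\<And>x. x \<in> S \<Longrightarrow> \<bar>U \<mu> x - V m x\<bar> \<le> D) \<Longrightarrow> \<omega> \<in> S \<Longrightarrow>
      \<bar>U \<mu> \<omega> - V n \<omega>\<bar> \<le> 4 / real k * \<bar>real n * \<mu> - 1\<bar> + 32 / (real k)\<^sup>2 + (1 - 1 / real k) * D"
proof -
  \<comment> \<open>Rounding up gives \<open>n \<le> k * h\<close>, hence a factor of at most
    \<open>1 - 1 / k\<close>. The overshoot is at most \<open>k \<le> n\<close>, so
    \<open>k * h \<le> 2 * n\<close>, and \<open>k \<ge> 4\<close> then yields
    \<open>2 * h \<le> n\<close>.\<close>
  define h where "h = Suc (n div k)"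
  define m where "m = n - h"
  have "k * h = n - n mod k + k"
    by (simp add: h_def minus_mod_eq_mult_div)
  moreover have "n mod k < k" "n mod k \<le> n"
    using k by auto
  ultimately have kh: "n \<le> k * h" "k * h \<le> 2 * n"
    using k by linarith+
  have "4 * h \<le> k * h"
    using k by simp
  then have "2 * h \<le> n"
    using kh by linarith
  moreover have "h \<ge> 1"
    by (simp add: h_def)
  ultimately have m: "m \<ge> 1" "m \<le> n" "n \<le> 2 * m" "m + h = n"
    unfolding m_def by linarith+
  have n0: "real n > 0" and k0: "real k > 0"
    using k by auto
  have rkh: "real n \<le> real k * real h" "real k * real h \<le> 2 * real n"
    using kh by (metis of_nat_le_iff of_nat_mult, metis of_nat_le_iff of_nat_mult of_nat_numeral)
  have hn: "real h / real n \<le> 2 / real k" "1 / real k \<le> real h / real n"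
    using rkh n0 k0 by (simp_all add: field_simps)
  have mn: "real m / real n \<le> 1 - 1 / real k"
  proof -
    have "real m / real n = 1 - real h / real n"
      using m n0 by (auto simp: field_simps)
    then show ?thesis
      using hn by simp
  qed
  have e1: "real h * \<bar>\<mu> - 1 / real n\<bar> \<le> 2 / real k * \<bar>real n * \<mu> - 1\<bar>"
  proof -
    have "\<mu> - 1 / real n = (real n * \<mu> - 1) / real n"
      using n0 by (simp add: field_simps)
    then have "real h * \<bar>\<mu> - 1 / real n\<bar> = real h / real n * \<bar>real n * \<mu> - 1\<bar>"
      using n0 by (simp add: abs_divide)
    also have "\<dots> \<le> 2 / real k * \<bar>real n * \<mu> - 1\<bar>"
      using hn by (intro mult_right_mono) auto
    finally show ?thesis .
  qed
  \<comment> \<open>From \<open>h / n \<le> 2 / k\<close> and \<open>n * \<mu> \<le> 2\<close>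
    follows \<open>h * \<mu> \<le> 4 / k\<close>; twice its square is the source of 32.\<close>
  have "real h * \<mu> = real h / real n * (real n * \<mu>)"
    using n0 by simp
  also have "\<dots> \<le> 2 / real k * 2"
    using hn \<mu> by (intro mult_mono) auto
  finally have "(real h * \<mu>)\<^sup>2 \<le> (4 / real k)\<^sup>2"
    using \<mu> by (intro power_mono) auto
  then have e2: "2 * (real h * \<mu>)\<^sup>2 \<le> 32 / (real k)\<^sup>2"
    by (simp add: power_divide)
  have "\<bar>U \<mu> \<omega> - V n \<omega>\<bar> \<le> 4 / real k * \<bar>real n * \<mu> - 1\<bar> + 32 / (real k)\<^sup>2 + (1 - 1 / real k) * D"
    if D: "\<And>x. x \<in> S \<Longrightarrow> \<bar>U \<mu> x - V m x\<bar> \<le> D" and \<omega>: "\<omega> \<in> S" for D \<omega>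
  proof -
    have "D \<ge> 0"
      using D[OF \<omega>] by linarith
    then have "real m / real n * D \<le> (1 - 1 / real k) * D"
      using mn by (rule mult_right_mono[rotated])
    then show ?thesis
      using block_step[OF \<mu>(1) m(1) \<open>h \<ge> 1\<close> D \<omega>] e1 e2 m(4) by simp
  qed
  then show thesis
    using m that by blast
qed

text \<open>Fix \<open>\<mu>\<close> and take \<open>n\<close> near \<open>1 / \<mu>\<close>. As
  \<open>V m\<close> and \<open>V n\<close> are both near \<open>v\<close>, the supremum
  \<open>D\<close> of the distance from \<open>U \<mu>\<close> to \<open>V n\<close> also bounds the
  distance to \<open>V m\<close>, up to \<open>2 * \<delta>\<close>. The contraction thus bounds
  \<open>D\<close> in terms of itself, and one application suffices.\<close>

lemma cesaro_imp_abel: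
  assumes lim: "uniform_limit S V v sequentially"
  shows "uniform_limit S U v (at_right 0)"
proof (rule uniform_limitI)
  fix e :: real
  assume e: "e > 0"
  obtain k0 :: nat where k0: "real k0 > 128 / e"
    using reals_Archimedean2 by blast
  define k where "k = max k0 4"
  have k4: "k \<ge> 4" and "real k > 128 / e"
    using k0 by (auto simp: k_def)
  then have k: "32 / real k < e / 4" and kpos: "real k > 0"
    using e by (auto simp: field_simps)
  \<comment> \<open>Solving for \<open>D\<close> divides the errors by \<open>1 / k\<close>, so
    \<open>\<delta>\<close> is chosen after \<open>k\<close> and small relative to
    \<open>1 / k\<close>.\<close>
  define \<delta> where "\<delta> = e / (8 * real k)"
  have \<delta>: "\<delta> > 0"
    using e k4 by (simp add: \<delta>_def)
  have k\<delta>: "2 * real k * \<delta> = e / 4" and \<delta>e: "\<delta> \<le> e / 8"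
    using e k4 by (auto simp: \<delta>_def field_simps)
  obtain N where N: "\<And>n \<omega>. n \<ge> N \<Longrightarrow> \<omega> \<in> S \<Longrightarrow> \<bar>V n \<omega> - v \<omega>\<bar> < \<delta>"
    using uniform_limitD[OF lim \<delta>] by (auto simp: eventually_sequentially dist_real_def)
  \<comment> \<open>\<open>\<mu> < 1 / B\<close> forces \<open>n > B\<close>, which gives
    \<open>k \<le> n\<close> and, through \<open>n \<le> 2 * m\<close>, also
    \<open>N \<le> m\<close>.\<close>
  define B where "B = real (k + 2 * N + 2)"
  have B: "B > 0"
    by (simp add: B_def)
  have "\<bar>U \<mu> \<omega> - v \<omega>\<bar> < e" if \<mu>: "0 < \<mu>" "\<mu> < min (1 / B) (e / 16)" and \<omega>: "\<omega> \<in> S" for \<mu> \<omega>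
  proof -
    \<comment> \<open>Rounding \<open>1 / \<mu>\<close> up keeps \<open>n * \<mu> - 1\<close>
      between 0 and \<open>\<mu>\<close>; the condition \<open>\<mu> < e / 16\<close> absorbs this
      mismatch.\<close>
    define n where "n = nat \<lceil>1 / \<mu>\<rceil>"
    have nr: "real n \<ge> 1 / \<mu>" "real n < 1 / \<mu> + 1"
    proof -
      have "real n = of_int \<lceil>1 / \<mu>\<rceil>"
        using \<mu> by (simp add: n_def)
      then show "real n \<ge> 1 / \<mu>" "real n < 1 / \<mu> + 1"
        by linarith+
    qed
    have "B < 1 / \<mu>"
      using \<mu> B by (simp add: field_simps)
    then have "real n > B"
      using nr by linarith
    then have n: "n > k + 2 * N + 2"
      unfolding B_def using of_nat_less_iff by blast
    have "1 / B \<le> 1"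
      by (simp add: B_def)
    then have \<mu>1: "\<mu> \<in> {0<..<1}"
      using \<mu> by auto
    have n\<mu>: "1 \<le> real n * \<mu>" "real n * \<mu> < 1 + \<mu>"
      using nr \<mu> by (auto simp: field_simps)
    have "k \<le> n" "real n * \<mu> \<le> 2"
      using n n\<mu> \<mu>1 by auto
    from contraction[OF k4 this(1) \<mu>1 this(2)]
    obtain m where m: "m \<ge> 1" "m \<le> n" "n \<le> 2 * m" and
      step: "\<And>D \<omega>. (\<And>x. x \<in> S \<Longrightarrow> \<bar>U \<mu> x - V m x\<bar> \<le> D) \<Longrightarrow> \<omega> \<in> S \<Longrightarrow>
        \<bar>U \<mu> \<omega> - V n \<omega>\<bar> \<le> 4 / real k * \<bar>real n * \<mu> - 1\<bar> + 32 / (real k)\<^sup>2 + (1 - 1 / real k) * D"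
      by metis
    have mN: "m \<ge> N" "n \<ge> N"
      using n m by linarith+
    define D where "D = (SUP x\<in>S. \<bar>U \<mu> x - V n x\<bar>)"
    have "bdd_above ((\<lambda>x. \<bar>U \<mu> x - V n x\<bar>) ` S)"
      using dist_le_1[OF _ \<mu>1, of n] n by (intro bdd_aboveI2[where M = 1]) auto
    then have D: "\<bar>U \<mu> x - V n x\<bar> \<le> D" if "x \<in> S" for x
      unfolding D_def using that by (intro cSUP_upper)
    have "\<bar>U \<mu> x - V m x\<bar> \<le> D + 2 * \<delta>" if "x \<in> S" for x
      using D[OF that] N[OF mN(1) that] N[OF mN(2) that] by linarith
    note step = step[OF this]
    have "D \<le> 4 / real k * \<bar>real n * \<mu> - 1\<bar> + 32 / (real k)\<^sup>2 + (1 - 1 / real k) * (D + 2 * \<delta>)"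
      unfolding D_def using nonempty step unfolding D_def by (intro cSUP_least) auto
    moreover have "4 / real k * \<bar>real n * \<mu> - 1\<bar> \<le> 4 / real k * \<mu>"
      using n\<mu> by (intro mult_left_mono) auto
    ultimately have "D \<le> 4 / real k * \<mu> + 32 / (real k)\<^sup>2 + (1 - 1 / real k) * (D + 2 * \<delta>)"
      by linarith
    \<comment> \<open>After multiplication by \<open>k\<close> the right side contains
      \<open>(k - 1) * D\<close>, so exactly one \<open>D\<close> survives on the left.\<close>
    then have "real k * D \<le>
        real k * (4 / real k * \<mu> + 32 / (real k)\<^sup>2 + (1 - 1 / real k) * (D + 2 * \<delta>))"
      using kpos by (intro mult_left_mono) auto
    also have "\<dots> = 4 * \<mu> + 32 / real k + (real k - 1) * (D + 2 * \<delta>)"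
      using kpos by (simp add: field_simps power2_eq_square)
    finally have "D \<le> 4 * \<mu> + 32 / real k + 2 * real k * \<delta>"
      using \<delta> by (simp add: algebra_simps)
    also have "\<dots> < e / 4 + e / 4 + e / 4"
      using \<mu> k k\<delta> by linarith
    finally show ?thesis
      using D[OF \<omega>] N[OF mN(2) \<omega>] \<delta>e by linarith
  qed
  then show "\<forall>\<^sub>F \<mu> in at_right 0. \<forall>\<omega>\<in>S. dist (U \<mu> \<omega>) (v \<omega>) < e"
    unfolding eventually_at_right_field dist_real_def
    using B e by (intro exI[of _ "min (1 / B) (e / 16)"]) auto
qed

text \<open>Here only \<open>U\<close> is controlled, so \<open>V m\<close> and \<open>V n\<close>
  cannot be compared directly. Instead \<open>U (1 / m)\<close> and \<open>U (1 / n)\<close> are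
  close, which carries a bound at \<open>(1 / m, m)\<close> over to \<open>(1 / n, n)\<close>. Since
  the index changes, no inequality for a single quantity results; the contraction is iterated from
  the trivial bound 1.\<close>

lemma abel_imp_cesaro:
  assumes lim: "uniform_limit S U u (at_right 0)"
  shows "uniform_limit S V u sequentially"
proof (rule uniform_limitI)
  fix e :: real
  assume e: "e > 0"
  obtain k0 :: nat where k0: "real k0 > 128 / e"
    using reals_Archimedean2 by blast
  define k where "k = max k0 4"
  have k4: "k \<ge> 4" and "real k > 128 / e"
    using k0 by (auto simp: k_def)
  then have k: "32 / real k < e / 4" and kpos: "real k > 0"
    using e by (auto simp: field_simps)
  define \<delta> where "\<delta> = e / (8 * real k)"
  have \<delta>: "\<delta> > 0"
    using e k4 by (simp add: \<delta>_def)
  have k\<delta>: "2 * real k * \<delta> = e / 4" and \<delta>e: "\<delta> \<le> e / 8"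
    using e k4 by (auto simp: \<delta>_def field_simps)
  define q where "q = 1 - 1 / real k"
  have q: "0 < q" "q < 1"
    using k4 by (auto simp: q_def field_simps)
  obtain b where b: "b > 0" "\<And>\<mu> \<omega>. 0 < \<mu> \<Longrightarrow> \<mu> < b \<Longrightarrow> \<omega> \<in> S \<Longrightarrow> \<bar>U \<mu> \<omega> - u \<omega>\<bar> < \<delta>"
    using uniform_limitD[OF lim \<delta>] by (auto simp: eventually_at_right_field dist_real_def)
  obtain N0 :: nat where N0: "1 / b < real N0"
    using reals_Archimedean2 by blast
  have close: "\<bar>U (1 / real n) \<omega> - u \<omega>\<bar> < \<delta>" if "n \<ge> N0" "n \<ge> 1" "\<omega> \<in> S" for n \<omega>
  proof (rule b(2))
    have "1 / b < real n"
      using N0 that by linarith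
    then show "1 / real n < b"
      using b(1) that by (simp add: field_simps)
  qed (use that in auto)
  \<comment> \<open>With \<open>\<mu> = 1 / n\<close> the term \<open>n * \<mu> - 1\<close>
    vanishes, and each round turns a bound \<open>D\<close> into
    \<open>32 / k^2 + q * (D + 2 * \<delta>)\<close>. The constant
    \<open>32 / k + 2 * k * \<delta>\<close> lies just above the fixed point of this map. The
    threshold \<open>N\<close> may depend on \<open>j\<close>, as a single \<open>j\<close> is used
    in the end.\<close>
  have iterate: "\<exists>N. \<forall>n\<ge>N. \<forall>\<omega>\<in>S. \<bar>U (1 / real n) \<omega> - V n \<omega>\<bar> \<le> 32 / real k + 2 * real k * \<delta> + q ^ j" for j
  proof (induction j)
    case 0
    \<comment> \<open>\<open>n \<ge> 2\<close> puts \<open>1 / n\<close> strictly below 1.\<close>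
    have "\<bar>U (1 / real n) \<omega> - V n \<omega>\<bar> \<le> 32 / real k + 2 * real k * \<delta> + q ^ 0" if "n \<ge> 2" "\<omega> \<in> S" for n \<omega>
    proof -
      have "0 \<le> 32 / real k + 2 * real k * \<delta>"
        using \<delta> by auto
      then show ?thesis
        using dist_le_1[of n "1 / real n" \<omega>] that by simp
    qed
    then show ?case
      by blast
  next
    case (Suc j)
    then obtain N where N: "\<And>n \<omega>. n \<ge> N \<Longrightarrow> \<omega> \<in> S \<Longrightarrow>
      \<bar>U (1 / real n) \<omega> - V n \<omega>\<bar> \<le> 32 / real k + 2 * real k * \<delta> + q ^ j"
      by blast
    have "\<bar>U (1 / real n) \<omega> - V n \<omega>\<bar> \<le> 32 / real k + 2 * real k * \<delta> + q ^ Suc j"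
      if n: "n \<ge> k + 2 * N + 2 * N0" and \<omega>: "\<omega> \<in> S" for n \<omega>
    proof -
      have kn: "k \<le> n" and \<mu>: "1 / real n \<in> {0<..<1}" "real n * (1 / real n) = 1"
        using n k4 by auto
      obtain m where m: "m \<ge> 1" "m \<le> n" "n \<le> 2 * m" and
        step: "\<And>D \<omega>. (\<And>x. x \<in> S \<Longrightarrow> \<bar>U (1 / real n) x - V m x\<bar> \<le> D) \<Longrightarrow> \<omega> \<in> S \<Longrightarrow>
          \<bar>U (1 / real n) \<omega> - V n \<omega>\<bar> \<le>
            4 / real k * \<bar>real n * (1 / real n) - 1\<bar> + 32 / (real k)\<^sup>2 + (1 - 1 / real k) * D"
        using contraction[OF k4 kn \<mu>(1)] \<mu>(2) by (metis one_le_numeral)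
      have mN: "m \<ge> N" "m \<ge> N0" "n \<ge> N0" "n \<ge> 1"
        using n m by linarith+
      have "\<bar>U (1 / real n) x - V m x\<bar> \<le> 32 / real k + 2 * real k * \<delta> + q ^ j + 2 * \<delta>"
        if "x \<in> S" for x
        using N[OF mN(1) that] close[OF mN(2) m(1) that] close[OF mN(3,4) that] by linarith
      from step[OF this \<omega>] have "\<bar>U (1 / real n) \<omega> - V n \<omega>\<bar> \<le>
          32 / (real k)\<^sup>2 + q * (32 / real k + 2 * real k * \<delta> + q ^ j + 2 * \<delta>)"
        unfolding \<mu>(2) q_def by simp
      also have "\<dots> = 32 / real k + 2 * real k * \<delta> + q ^ Suc j - 2 * \<delta> / real k"
        unfolding power_Suc distrib_left using kpos
        by (simp add: q_def field_simps power2_eq_square)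
      finally show ?thesis
        using \<delta> kpos by (smt (verit) divide_nonneg_pos)
    qed
    then show ?case
      by blast
  qed
  obtain j where j: "q ^ j < e / 8"
    using real_arch_pow_inv[of "e / 8" q] e q by auto
  obtain N where N: "\<And>n \<omega>. n \<ge> N \<Longrightarrow> \<omega> \<in> S \<Longrightarrow>
      \<bar>U (1 / real n) \<omega> - V n \<omega>\<bar> \<le> 32 / real k + 2 * real k * \<delta> + q ^ j"
    using iterate[of j] by blast
  have "\<bar>V n \<omega> - u \<omega>\<bar> < e" if n: "n \<ge> N + N0 + 1" and \<omega>: "\<omega> \<in> S" for n \<omega>
  proof -
    have "n \<ge> N" "n \<ge> N0" "n \<ge> 1"
      using n by auto
    then show ?thesis
      using N[of n \<omega>] close[of n \<omega>] \<omega> k k\<delta> \<delta>e j e by linarith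
  qed
  then show "\<forall>\<^sub>F n in sequentially. \<forall>\<omega>\<in>S. dist (V n \<omega>) (u \<omega>) < e"
    unfolding eventually_sequentially dist_real_def by blast
qed

text \<open>The limit function is the same on both sides, so this also yields the equality of the
  limits.\<close>

theorem tauberian:
  "uniform_limit S V v sequentially \<longleftrightarrow> uniform_limit S U v (at_right 0)"
  using cesaro_imp_abel abel_imp_cesaro by blast

end

section \<open>Nonexpansiveness of the value map\<close>

text \<open>Infima and suprema are monotone and commute with adding a constant; the common bound
  \<open>C\<close> makes them meaningful in the conditionally complete reals.\<close>

lemma SUP_INF_mono_add:
  fixes f f' :: "'a \<Rightarrow> 'b \<Rightarrow> real"
  assumes "A \<noteq> {}" "B \<noteq> {}"
    and le: "\<And>a b. a \<in> A \<Longrightarrow> b \<in> B \<Longrightarrow> f a b \<le> f' a b + D"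
    and bound: "\<And>a b. a \<in> A \<Longrightarrow> b \<in> B \<Longrightarrow> \<bar>f a b\<bar> \<le> C" "\<And>a b. a \<in> A \<Longrightarrow> b \<in> B \<Longrightarrow> \<bar>f' a b\<bar> \<le> C"
  shows "(SUP a\<in>A. INF b\<in>B. f a b) \<le> (SUP a\<in>A. INF b\<in>B. f' a b) + D"
proof (rule cSUP_least)
  fix a
  assume a: "a \<in> A"
  have bdd: "bdd_below (f x ` B)" "bdd_below (f' x ` B)" if "x \<in> A" for x
    using bound that by (auto intro!: bdd_belowI2[where m = "- C"] simp: abs_le_iff minus_le_iff)
  obtain b0 where b0: "b0 \<in> B"
    using \<open>B \<noteq> {}\<close> by blast
  have "bdd_above ((\<lambda>x. INF b\<in>B. f' x b) ` A)"
  proof (rule bdd_aboveI2)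
    fix x
    assume x: "x \<in> A"
    show "(INF b\<in>B. f' x b) \<le> C"
      by (rule order_trans[OF cINF_lower[OF bdd(2)[OF x] b0]]) (use bound(2)[OF x b0] in auto)
  qed
  then have *: "(INF b\<in>B. f' a b) \<le> (SUP a\<in>A. INF b\<in>B. f' a b)"
    using a by (rule cSUP_upper[rotated])
  have "(INF b\<in>B. f a b) - D \<le> (INF b\<in>B. f' a b)"
  proof (rule cINF_greatest)
    fix b
    assume b: "b \<in> B"
    show "(INF b\<in>B. f a b) - D \<le> f' a b"
      using cINF_lower[OF bdd(1)[OF a] b] le[OF a b] by linarith
  qed fact
  with * show "(INF b\<in>B. f a b) \<le> (SUP a\<in>A. INF b\<in>B. f' a b) + D"
    by linarith
qed fact

text \<open>One initial state is fixed, since the value there involves only the strategies and laws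
  of that state. Uniformity comes from bounds that do not depend on it.\<close>

locale game =
  fixes L :: "'w \<Rightarrow> 'l set" and M :: "'w \<Rightarrow> 'm set" and P :: "'w \<Rightarrow> 'l \<Rightarrow> 'm \<Rightarrow> 'z measure"
    and K :: "'z set" and \<A> :: "'z set set" and \<omega> :: 'w
  assumes sigma: "sigma_algebra K \<A>" and K: "K \<noteq> {}"
    and L: "L \<omega> \<noteq> {}" and M: "M \<omega> \<noteq> {}"
    and P: "\<And>l m. l \<in> L \<omega> \<Longrightarrow> m \<in> M \<omega> \<Longrightarrow>
      prob_space (P \<omega> l m) \<and> space (P \<omega> l m) = K \<and> sets (P \<omega> l m) = \<A>"
begin

lemma bounded_payoff_integrable:
  assumes "c \<in> bounded_payoffs K \<A>" and lm: "l \<in> L \<omega>" "m \<in> M \<omega>"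
  shows "integrable (P \<omega> l m) c"
proof -
  interpret prob_space "P \<omega> l m"
    using P[OF lm] by simp
  \<comment> \<open>\<open>\<A>\<close> is already a sigma-algebra, so generating from it adds no
    sets.\<close>
  have eq: "sets (P \<omega> l m) = sets (sigma K \<A>)"
    using P[OF lm] sigma by (simp add: sigma_algebra.sets_measure_of_eq)
  have "c \<in> borel_measurable (P \<omega> l m)"
    using assms(1) unfolding bounded_payoffs_def by (simp add: measurable_cong_sets[OF eq refl])
  moreover obtain C where "\<And>z. z \<in> K \<Longrightarrow> \<bar>c z\<bar> \<le> C"
    using assms(1) unfolding bounded_payoffs_def by (auto simp: bounded_real)
  ultimately show ?thesis
    using P[OF lm] by (intro integrable_const_bound[where B = C] AE_I2) auto
qed

lemma expectation_abs_le:
  assumes "c \<in> bounded_payoffs K \<A>" "l \<in> L \<omega>" "m \<in> M \<omega>" "\<And>z. z \<in> K \<Longrightarrow> \<bar>c z\<bar> \<le> C"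
  shows "\<bar>prob_space.expectation (P \<omega> l m) c\<bar> \<le> C"
proof -
  interpret prob_space "P \<omega> l m"
    using P assms by simp
  have "expectation c \<le> C" "- C \<le> expectation c"
    using bounded_payoff_integrable[OF assms(1-3)] P[OF assms(2,3)] assms(4)
    by (auto intro!: integral_le_const integral_ge_const AE_I2 simp: abs_le_iff minus_le_iff)
  then show ?thesis
    by linarith
qed

text \<open>Expectation under a probability moves by exactly \<open>D\<close> when the payoff does.
  The one-sided form serves twice: exchanging the payoffs gives nonexpansiveness, and
  \<open>D = 0\<close> against constant payoffs gives the range of the values.\<close>

lemma game_value_mono_add:
  assumes c: "c \<in> bounded_payoffs K \<A>" "c' \<in> bounded_payoffs K \<A>"
    and le: "\<And>z. z \<in> K \<Longrightarrow> c z \<le> c' z + D"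
  shows "game_value L M P c \<omega> \<le> game_value L M P c' \<omega> + D"
proof -
  obtain C1 C2 where "\<And>z. z \<in> K \<Longrightarrow> \<bar>c z\<bar> \<le> C1" "\<And>z. z \<in> K \<Longrightarrow> \<bar>c' z\<bar> \<le> C2"
    using c unfolding bounded_payoffs_def by (auto simp: bounded_real)
  then have C: "\<bar>c z\<bar> \<le> max C1 C2" "\<bar>c' z\<bar> \<le> max C1 C2" if "z \<in> K" for z
    using that by (simp_all add: le_max_iff_disj)
  have "prob_space.expectation (P \<omega> l m) c \<le> prob_space.expectation (P \<omega> l m) c' + D"
    if lm: "l \<in> L \<omega>" "m \<in> M \<omega>" for l m
  proof -
    interpret prob_space "P \<omega> l m"
      using P[OF lm] by simp
    note int = bounded_payoff_integrable[OF c(1) lm] bounded_payoff_integrable[OF c(2) lm]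
    have "expectation c \<le> expectation (\<lambda>z. c' z + D)"
      using int le P[OF lm] by (intro integral_mono) auto
    also have "\<dots> = expectation c' + D"
      using int by (simp add: prob_space)
    finally show ?thesis .
  qed
  then show ?thesis
    unfolding game_value_def
    using L M expectation_abs_le[OF c(1) _ _ C(1)] expectation_abs_le[OF c(2) _ _ C(2)]
    by (intro SUP_INF_mono_add) auto
qed

lemma game_value_nonexpansive:
  assumes "c \<in> bounded_payoffs K \<A>" "c' \<in> bounded_payoffs K \<A>"
    and le: "\<And>z. z \<in> K \<Longrightarrow> \<bar>c z - c' z\<bar> \<le> D"
  shows "\<bar>game_value L M P c \<omega> - game_value L M P c' \<omega>\<bar> \<le> D"
proof -
  have "c z \<le> c' z + D" "c' z \<le> c z + D" if "z \<in> K" for z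
    using le[OF that] by linarith+
  from game_value_mono_add[OF assms(1,2) this(1)] game_value_mono_add[OF assms(2,1) this(2)]
  show ?thesis
    by linarith
qed

lemma game_value_const: "game_value L M P (\<lambda>_. b) \<omega> = b"
proof -
  have "prob_space.expectation (P \<omega> l m) (\<lambda>_. b) = b" if "l \<in> L \<omega>" "m \<in> M \<omega>" for l m
    using P[OF that] prob_space.prob_space[of "P \<omega> l m"] by simp
  then have "(INF m\<in>M \<omega>. prob_space.expectation (P \<omega> l m) (\<lambda>_. b)) = (INF m\<in>M \<omega>. b)"
    if "l \<in> L \<omega>" for l
    using that by (intro INF_cong) auto
  then have "game_value L M P (\<lambda>_. b) \<omega> = (SUP l\<in>L \<omega>. INF m\<in>M \<omega>. b)"
    unfolding game_value_def by (intro SUP_cong refl)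
  then show ?thesis
    using L M by simp
qed

lemma game_value_range:
  assumes "c \<in> bounded_payoffs K \<A>" and c: "c ` K \<subseteq> {a..b}"
  shows "game_value L M P c \<omega> \<in> {a..b}"
proof -
  have const: "(\<lambda>_. x) \<in> bounded_payoffs K \<A>" for x :: real
    unfolding bounded_payoffs_def by (simp add: image_constant_conv)
  have "game_value L M P c \<omega> \<le> game_value L M P (\<lambda>_. b) \<omega> + 0"
    using c by (intro game_value_mono_add assms const) auto
  moreover have "game_value L M P (\<lambda>_. a) \<omega> \<le> game_value L M P c \<omega> + 0"
    using c by (intro game_value_mono_add assms const) auto
  ultimately show ?thesis
    by (simp add: game_value_const)
qed

end

section \<open>Cesaro and Abel weights on a block\<close>

text \<open>First-order expansion with error \<open>(h * \<mu>)^2\<close>, which is what makes the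
  block errors quadratic in \<open>1 / k\<close>. The lower bound is Bernoulli's inequality.\<close>

lemma one_minus_power_bounds:
  fixes \<mu> :: real
  assumes "0 \<le> \<mu>" "\<mu> \<le> 1"
  shows "1 - real h * \<mu> \<le> (1 - \<mu>) ^ h" "(1 - \<mu>) ^ h \<le> 1 - real h * \<mu> + (real h * \<mu>)\<^sup>2"
proof -
  show "1 - real h * \<mu> \<le> (1 - \<mu>) ^ h"
    using Bernoulli_inequality[of "- \<mu>" h] assms by simp
  show "(1 - \<mu>) ^ h \<le> 1 - real h * \<mu> + (real h * \<mu>)\<^sup>2"
  proof (induction h)
    case (Suc h)
    have "(1 - \<mu>) ^ Suc h \<le> (1 - \<mu>) * (1 - real h * \<mu> + (real h * \<mu>)\<^sup>2)"
      using Suc assms by (simp add: mult_left_mono)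
    also have "\<dots> = 1 - real (Suc h) * \<mu> + (real (Suc h) * \<mu>)\<^sup>2
        - (real h * \<mu>\<^sup>2 + \<mu>\<^sup>2 + (real h)\<^sup>2 * \<mu> ^ 3)"
      by (simp add: algebra_simps power2_eq_square power3_eq_cube)
    also have "\<dots> \<le> 1 - real (Suc h) * \<mu> + (real (Suc h) * \<mu>)\<^sup>2"
    proof -
      have "0 \<le> real h * \<mu>\<^sup>2 + \<mu>\<^sup>2 + (real h)\<^sup>2 * \<mu> ^ 3"
        using assms by (intro add_nonneg_nonneg mult_nonneg_nonneg) auto
      then show ?thesis
        by linarith
    qed
    finally show ?case .
  qed simp
qed

text \<open>The difference splits into stage weights on the block, masses of the remainder, and
  values of the remainder. Since \<open>a\<close> and \<open>u\<close> lie in the unit interval, the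
  first two parts reduce to differences of weights.\<close>

lemma block_payoff_diff:
  fixes a :: "nat \<Rightarrow> real"
  assumes \<mu>: "\<mu> \<in> {0<..<1}" and h: "h \<ge> 1"
    and a: "\<And>t. a t \<in> {0..1}" and u: "u \<in> {0..1}" and D: "\<bar>u - v\<bar> \<le> D"
  shows "\<bar>(\<mu> * (\<Sum>t<h. (1 - \<mu>) ^ t * a t) + (1 - \<mu>) ^ h * u)
      - (1 / real (m + h) * (\<Sum>t<h. a t) + real m / real (m + h) * v)\<bar>
    \<le> 2 * (real h * \<bar>\<mu> - 1 / real (m + h)\<bar>) + 2 * (real h * \<mu>)\<^sup>2 + real m / real (m + h) * D"
proof -
  \<comment> \<open>\<open>r\<close> is the weight of one stage in the mean over
    \<open>m + h\<close> stages, \<open>\<rho>\<close> the mass left after \<open>h\<close> of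
    them.\<close>
  define r where "r = 1 / real (m + h)"
  define \<rho> where "\<rho> = real m / real (m + h)"
  have \<rho>: "\<rho> = 1 - real h * r" "\<rho> \<ge> 0"
    using h by (auto simp: \<rho>_def r_def field_simps)
  have bounds: "1 - real t * \<mu> \<le> (1 - \<mu>) ^ t" "(1 - \<mu>) ^ t \<le> 1 - real t * \<mu> + (real t * \<mu>)\<^sup>2" for t
    using one_minus_power_bounds[of \<mu> t] \<mu> by auto
  \<comment> \<open>Within the block discounting lowers a weight by at most
    \<open>\<mu> * (h * \<mu>)\<close>; over \<open>h\<close> stages this adds up to
    \<open>(h * \<mu>)^2\<close>.\<close>
  have weight: "\<bar>(\<mu> * (1 - \<mu>) ^ t - r) * a t\<bar> \<le> \<bar>\<mu> - r\<bar> + real h * \<mu>\<^sup>2" if t: "t < h" for t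
  proof -
    have "1 - (1 - \<mu>) ^ t \<le> real t * \<mu>"
      using bounds(1)[of t] by simp
    also have "\<dots> \<le> real h * \<mu>"
      using t \<mu> by (intro mult_right_mono) auto
    finally have "\<mu> * (1 - (1 - \<mu>) ^ t) \<le> \<mu> * (real h * \<mu>)"
      using \<mu> by (intro mult_left_mono) auto
    moreover have "0 \<le> \<mu> * (1 - (1 - \<mu>) ^ t)"
      using \<mu> by (simp add: power_le_one)
    ultimately have "\<bar>\<mu> * (1 - \<mu>) ^ t - r\<bar> \<le> \<bar>\<mu> - r\<bar> + real h * \<mu>\<^sup>2"
      by (simp add: algebra_simps power2_eq_square)
    moreover have "\<bar>(\<mu> * (1 - \<mu>) ^ t - r) * a t\<bar> \<le> \<bar>\<mu> * (1 - \<mu>) ^ t - r\<bar>"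
      using a[of t] by (simp add: abs_mult mult_left_le)
    ultimately show ?thesis
      by linarith
  qed
  have "\<bar>\<Sum>t<h. (\<mu> * (1 - \<mu>) ^ t - r) * a t\<bar> \<le> (\<Sum>t<h. \<bar>\<mu> - r\<bar> + real h * \<mu>\<^sup>2)"
    using weight by (intro order_trans[OF sum_abs] sum_mono) auto
  also have "\<dots> = real h * \<bar>\<mu> - r\<bar> + (real h * \<mu>)\<^sup>2"
    by (simp add: algebra_simps power2_eq_square)
  finally have 1: "\<bar>\<Sum>t<h. (\<mu> * (1 - \<mu>) ^ t - r) * a t\<bar> \<le> real h * \<bar>\<mu> - r\<bar> + (real h * \<mu>)\<^sup>2" .
  have "\<bar>(1 - \<mu>) ^ h - \<rho>\<bar> \<le> \<bar>real h * (\<mu> - r)\<bar> + (real h * \<mu>)\<^sup>2"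
    using bounds[of h] unfolding \<rho>(1) right_diff_distrib by linarith
  moreover have "\<bar>((1 - \<mu>) ^ h - \<rho>) * u\<bar> \<le> \<bar>(1 - \<mu>) ^ h - \<rho>\<bar>"
    using u by (simp add: abs_mult mult_left_le)
  ultimately have 2: "\<bar>((1 - \<mu>) ^ h - \<rho>) * u\<bar> \<le> real h * \<bar>\<mu> - r\<bar> + (real h * \<mu>)\<^sup>2"
    by (simp add: abs_mult)
  have 3: "\<bar>\<rho> * (u - v)\<bar> \<le> \<rho> * D"
    using \<rho>(2) D by (simp add: abs_mult mult_left_mono)
  \<comment> \<open>The factor of \<open>u - v\<close> is the Cesaro mass \<open>\<rho>\<close>, so
    that \<open>D\<close> enters with the contraction factor \<open>m / (m + h)\<close>.\<close>
  have "(\<mu> * (\<Sum>t<h. (1 - \<mu>) ^ t * a t) + (1 - \<mu>) ^ h * u) - (r * (\<Sum>t<h. a t) + \<rho> * v)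
    = (\<Sum>t<h. (\<mu> * (1 - \<mu>) ^ t - r) * a t) + ((1 - \<mu>) ^ h - \<rho>) * u + \<rho> * (u - v)"
    by (simp add: algebra_simps sum_distrib_left sum_subtractf)
  then show ?thesis
    unfolding r_def[symmetric] \<rho>_def[symmetric] using 1 2 3 by linarith
qed

section \<open>Range of the payoffs\<close>

lemma cesaro_payoff_range:
  assumes "\<And>t. g (z (real t)) \<in> {0..1}"
  shows "cesaro_payoff g n z \<in> {0..1}"
proof -
  have "(\<Sum>t<n. g (z (real t))) \<le> real n" "0 \<le> (\<Sum>t<n. g (z (real t)))"
    using assms sum_bounded_above[of "{..<n}" "\<lambda>t. g (z (real t))" 1] by (auto intro: sum_nonneg)
  \<comment> \<open>For \<open>n = 0\<close> the empty sum makes the payoff 0.\<close>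
  then show ?thesis
    unfolding cesaro_payoff_def by (cases "n = 0") (auto simp: field_simps)
qed

lemma abel_payoff_range:
  assumes g: "\<And>t. g (z (real t)) \<in> {0..1}" and \<mu>: "\<mu> \<in> {0<..<1}"
  shows "abel_payoff g \<mu> z \<in> {0..1}"
proof -
  have geo: "summable (\<lambda>t. (1 - \<mu>) ^ t)" "(\<Sum>t. (1 - \<mu>) ^ t) = 1 / \<mu>"
    using \<mu> by (auto simp: summable_geometric suminf_geometric)
  have le: "(1 - \<mu>) ^ t * g (z (real t)) \<le> (1 - \<mu>) ^ t" "0 \<le> (1 - \<mu>) ^ t * g (z (real t))" for t
    using g[of t] \<mu> by (auto intro!: mult_left_le)
  \<comment> \<open>Summability is what gives the infinite sum its meaning; the geometric series
    dominates.\<close>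
  have sm: "summable (\<lambda>t. (1 - \<mu>) ^ t * g (z (real t)))"
  proof (rule summable_comparison_test'[OF geo(1)])
    show "norm ((1 - \<mu>) ^ t * g (z (real t))) \<le> (1 - \<mu>) ^ t" for t
      using le[of t] by (simp only: real_norm_def abs_of_nonneg)
  qed
  have "(\<Sum>t. (1 - \<mu>) ^ t * g (z (real t))) \<le> 1 / \<mu>"
    using suminf_le[OF le(1) sm geo(1)] geo(2) by simp
  then have "\<mu> * (\<Sum>t. (1 - \<mu>) ^ t * g (z (real t))) \<le> 1"
    using \<mu> by (simp add: field_simps)
  moreover have "0 \<le> (\<Sum>t. (1 - \<mu>) ^ t * g (z (real t)))"
    using sm le(2) by (rule suminf_nonneg)
  ultimately show ?thesis
    unfolding abel_payoff_def using \<mu> by simp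
qed

section \<open>Reduction of the game to the Tauberian theorem\<close>

theorem corollary2:
  fixes \<Omega> :: "'w set"
    and K :: "(real \<Rightarrow> 'w) set"
    and \<A> :: "(real \<Rightarrow> 'w) set set"
    and g :: "'w \<Rightarrow> real"
    and L :: "'w \<Rightarrow> 'l set"
    and M :: "'w \<Rightarrow> 'm set"
    and P :: "'w \<Rightarrow> 'l \<Rightarrow> 'm \<Rightarrow> (real \<Rightarrow> 'w) measure"
    and W :: "((real \<Rightarrow> 'w) \<Rightarrow> real) \<Rightarrow> 'w \<Rightarrow> real"
  assumes "\<Omega> \<noteq> {}"
    and "K \<noteq> {}"
    and "K \<subseteq> {0..} \<rightarrow>\<^sub>E \<Omega>"
    and "g \<in> \<Omega> \<rightarrow> {0..1}"
    and "\<And>z. z \<in> K \<Longrightarrow> (\<lambda>t. g (z t)) \<in> borel_measurable (restrict_space borel {0..})"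
    and "sigma_algebra K \<A>"
    and "\<And>\<omega>. \<omega> \<in> \<Omega> \<Longrightarrow> L \<omega> \<noteq> {}"
    and "\<And>\<omega>. \<omega> \<in> \<Omega> \<Longrightarrow> M \<omega> \<noteq> {}"
    and "\<And>\<omega> l m. \<omega> \<in> \<Omega> \<Longrightarrow> l \<in> L \<omega> \<Longrightarrow> m \<in> M \<omega> \<Longrightarrow>
           prob_space (P \<omega> l m) \<and> space (P \<omega> l m) = K \<and> sets (P \<omega> l m) = \<A>"
    and "\<And>z k t. z \<in> K \<Longrightarrow> t \<in> {0<..<1} \<Longrightarrow> z (real k + t) = z (real k)"
    and "\<And>n. n \<ge> 1 \<Longrightarrow> cesaro_payoff g n \<in> borel_measurable (sigma K \<A>)"
    and "\<And>\<mu>. \<mu> \<in> {0<..<1} \<Longrightarrow> abel_payoff g \<mu> \<in> borel_measurable (sigma K \<A>)"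
    and "W = game_value L M P"
    and "cesaro_DPP \<Omega> K \<A> g W"
    and "abel_DPP \<Omega> K \<A> g W"
  shows "((\<exists>v. uniform_limit \<Omega> (\<lambda>n. W (cesaro_payoff g n)) v sequentially) \<longleftrightarrow>
          (\<exists>w. uniform_limit \<Omega> (\<lambda>\<mu>. W (abel_payoff g \<mu>)) w (at_right 0))) \<and>
         ((\<exists>v. uniform_limit \<Omega> (\<lambda>n. W (cesaro_payoff g n)) v sequentially) \<or>
          (\<exists>w. uniform_limit \<Omega> (\<lambda>\<mu>. W (abel_payoff g \<mu>)) w (at_right 0)) \<longrightarrow>
          (\<forall>\<omega>\<in>\<Omega>. lim (\<lambda>n. W (cesaro_payoff g n) \<omega>)
                  = Lim (at_right 0) (\<lambda>\<mu>. W (abel_payoff g \<mu>) \<omega>)))"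
proof -
  note nonempty = assms(1) and K_maps = assms(3) and g = assms(4)
    and W = assms(13) and cesaro = assms(14) and abel = assms(15)
  have game: "game L M P K \<A> \<omega>" if "\<omega> \<in> \<Omega>" for \<omega>
    by (rule game.intro) (fact assms(2,6) assms(7-9)[OF that])+
  have zt: "z (real t) \<in> \<Omega>" if "z \<in> K" for z t
    using K_maps that by (auto simp: PiE_iff)
  then have gz: "g (z (real t)) \<in> {0..1}" if "z \<in> K" for z t
    using g that by auto
  have payoff: "c \<in> bounded_payoffs K \<A>"
    if "c \<in> borel_measurable (sigma K \<A>)" "c ` K \<subseteq> {0..1}" for c
    using that bounded_subset[OF bounded_closed_interval] unfolding bounded_payoffs_def by blast
  interpret tauberian_pair \<Omega> "\<lambda>n. W (cesaro_payoff g n)" "\<lambda>\<mu>. W (abel_payoff g \<mu>)"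
  proof
    show "\<Omega> \<noteq> {}"
      by fact
    show "W (cesaro_payoff g n) \<omega> \<in> {0..1}" if "n \<ge> 1" "\<omega> \<in> \<Omega>" for n \<omega>
    proof -
      have "cesaro_payoff g n ` K \<subseteq> {0..1}"
        using cesaro_payoff_range gz by blast
      then show ?thesis
        unfolding W using that assms(11) by (intro game.game_value_range[OF game] payoff)
    qed
    show U_range: "W (abel_payoff g \<mu>) \<omega> \<in> {0..1}" if "\<mu> \<in> {0<..<1}" "\<omega> \<in> \<Omega>" for \<mu> \<omega>
    proof -
      have "abel_payoff g \<mu> ` K \<subseteq> {0..1}"
        using abel_payoff_range[OF _ that(1)] gz by blast
      then show ?thesis
        unfolding W using that assms(12) by (intro game.game_value_range[OF game] payoff)
    qed
    fix \<mu> :: real and m h :: nat and D \<omega>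
    assume \<mu>: "\<mu> \<in> {0<..<1}" and m: "m \<ge> 1" and h: "h \<ge> 1" and \<omega>: "\<omega> \<in> \<Omega>"
      and D: "\<And>x. x \<in> \<Omega> \<Longrightarrow> \<bar>W (abel_payoff g \<mu>) x - W (cesaro_payoff g m) x\<bar> \<le> D"
    define c where "c = (\<lambda>z. \<mu> * (\<Sum>t<h. (1 - \<mu>) ^ t * g (z (real t)))
      + (1 - \<mu>) ^ h * W (abel_payoff g \<mu>) (z (real h)))"
    define c' where "c' = (\<lambda>z. 1 / real (m + h) * (\<Sum>t<h. g (z (real t)))
      + real m / real (m + h) * W (cesaro_payoff g m) (z (real h)))"
    \<comment> \<open>Both principles express the value through one block of \<open>h\<close> steps,
      so the two values are images under \<open>W\<close> of payoffs comparable process by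
      process.\<close>
    have c: "c \<in> bounded_payoffs K \<A>" "W (abel_payoff g \<mu>) \<omega> = W c \<omega>"
      using abel \<mu> h \<omega> unfolding abel_DPP_def Let_def c_def by auto
    have c': "c' \<in> bounded_payoffs K \<A>" "W (cesaro_payoff g (m + h)) \<omega> = W c' \<omega>"
      using cesaro m h \<omega> unfolding cesaro_DPP_def Let_def c'_def by auto
    show "\<bar>W (abel_payoff g \<mu>) \<omega> - W (cesaro_payoff g (m + h)) \<omega>\<bar> \<le>
        2 * (real h * \<bar>\<mu> - 1 / real (m + h)\<bar>) + 2 * (real h * \<mu>)\<^sup>2 + real m / real (m + h) * D"
      unfolding c(2) c'(2) unfolding W
    proof (rule game.game_value_nonexpansive[OF game[OF \<omega>] c(1) c'(1)])
      fix z
      assume z: "z \<in> K"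
      show "\<bar>c z - c' z\<bar> \<le>
          2 * (real h * \<bar>\<mu> - 1 / real (m + h)\<bar>) + 2 * (real h * \<mu>)\<^sup>2 + real m / real (m + h) * D"
        unfolding c_def c'_def using gz[OF z] zt[OF z]
        by (intro block_payoff_diff[OF \<mu> h] U_range[OF \<mu>] D)
    qed
  qed
  \<comment> \<open>\<open>lim\<close> and \<open>Lim\<close> are total choice operators; each is
    identified with \<open>v \<omega>\<close> by actual convergence, on the Abel side through
    \<open>tauberian\<close>.\<close>
  have "lim (\<lambda>n. W (cesaro_payoff g n) \<omega>) = Lim (at_right 0) (\<lambda>\<mu>. W (abel_payoff g \<mu>) \<omega>)"
    if v: "uniform_limit \<Omega> (\<lambda>n. W (cesaro_payoff g n)) v sequentially" and \<omega>: "\<omega> \<in> \<Omega>" for v \<omega>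
    using limI[OF tendsto_uniform_limitI[OF v \<omega>]]
      tendsto_Lim[OF _ tendsto_uniform_limitI[OF v[unfolded tauberian] \<omega>]] by simp
  then show ?thesis
    using tauberian by blast
qed

end
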